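(* Let $G$ be a road-network graph, $Q$ a query community, $v_q$ the query location, $\theta$ a similarity threshold, and $k\ge 1$. Assume that $C_1,C_2,\dots,C_k$ are $k$ distinct candidate communities in $G$ satisfying $sim(C_i,Q)>\theta$ for $1\le i\le k$, where $C_k$ has the $k$-th (i.e. largest) distance to the query location among them: $dist(v_q,C_i)\le dist(v_q,C_k)$ for all $1\le i\le k$. If a community $C_l$ in $G$, different from $C_1,\dots,C_k$, satisfies $dist(v_q,C_l)\ge dist(v_q,C_k)$, then $C_l$ can be safely pruned, that is, $C_l$ is not among the communities returned by the top-$k$ community similarity search query with query community $Q$, query location $v_q$ and threshold $\theta$.
   Context: A road-network graph $G$ is a connected planar graph embedded in the plane, whose edges are road segments and whose vertices are road intersection points. $G$ is divided into non-overlapping unit patterns: a unit pattern is either a single edge not lying on a cycle, or a polygon bounded by a simple cycle (triangle, rectangle, pentagon, ...). The type of a unit pattern is its shape; there are $n$ types in total, indexed by $h\in\{1,\dots,n\}$. Each unit pattern $c$ has a point-of-interest (POI) vector $c.vec$ with non-negative entries, normalized to Euclidean length $1$, so the cosine similarity of two POI vectors is their dot product: $cos\_sim(A,B)=\sum_i A_iB_i$. Fix a radius $r$. A spatial community centered at a vertex $v_c\in V(G)$ is a connected subgraph of $G$ all of whose unit patterns $c$ satisfy $mindist(c,v_c)\le r$, where $mindist$ is the minimum Euclidean distance from $v_c$ to $c$. A query community $Q$ is a given such community. For a community $C_l$, write $c_h[1],\dots,c_h[|c_h|]$ for the unit patterns of type $h$ in $C_l$; for $Q$, write $q_h[1],\dots,q_h[|q_h|]$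 for those of type $h$ in $Q$ (with $|q_h|\ge1$ for each $h$). The similarity score is $$sim(C_l,Q)=\sum_{h=1}^{n}\frac{\sum_{i=1}^{|c_h|}\sum_{j=1}^{|q_h|}cos\_sim(c_h[i].vec,\,q_h[j].vec)}{|q_h|\cdot n}.$$ $dist(v_q,C)$ is the Euclidean distance from $v_q$ to the center vertex of the community $C$. A top-$k$ community similarity search query retrieves a set of $k$ communities from $G$ such that each retrieved community $C$ satisfies $sim(C,Q)\ge\theta$, and for each retrieved $C$ and each non-retrieved community $C'$ with $sim(C',Q)\ge\theta$ one has $dist(v_q,C)<dist(v_q,C')$. *)

theory Defs
  imports "HOL-Analysis.Analysis"
begin

type_synonym point = "real^2"

record plane_graph =
  verts :: "point set"
  edges :: "point set set"

text \<open>An edge is the two-element set of its endpoints; the road segment it stands for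
  is the straight segment between them.\<close>

definition simple_graph :: "plane_graph \<Rightarrow> bool" where
  "simple_graph G \<longleftrightarrow> finite (verts G) \<and>
     (\<forall>e \<in> edges G. \<exists>u \<in> verts G. \<exists>v \<in> verts G. u \<noteq> v \<and> e = {u, v})"

definition connected_graph :: "plane_graph \<Rightarrow> bool" where
  "connected_graph G \<longleftrightarrow> verts G \<noteq> {} \<and>
     (\<forall>u \<in> verts G. \<forall>v \<in> verts G. (u, v) \<in> {(x, y). {x, y} \<in> edges G}\<^sup>*)"

definition segment_of :: "point set \<Rightarrow> point set" where
  "segment_of e = convex hull e"

definition plane_embedded :: "plane_graph \<Rightarrow> bool" where
  "plane_embedded G \<longleftrightarrow>
     (\<forall>e \<in> edges G. segment_of e \<inter> verts G = e) \<and>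
     (\<forall>e \<in> edges G. \<forall>f \<in> edges G. e \<noteq> f \<longrightarrow> segment_of e \<inter> segment_of f = e \<inter> f)"

definition subgraph_of :: "plane_graph \<Rightarrow> plane_graph \<Rightarrow> bool" where
  "subgraph_of H G \<longleftrightarrow> simple_graph H \<and> verts H \<subseteq> verts G \<and> edges H \<subseteq> edges G"

definition cycle_edges :: "point list \<Rightarrow> point set set" where
  "cycle_edges p = {{p ! i, p ! (Suc i mod length p)} | i. i < length p}"

definition simple_cycle :: "plane_graph \<Rightarrow> point set set \<Rightarrow> bool" where
  "simple_cycle G c \<longleftrightarrow> c \<subseteq> edges G \<and>
     (\<exists>p. 3 \<le> length p \<and> distinct p \<and> c = cycle_edges p)"

text \<open>A unit pattern is represented by its set of edges: a singleton, or the boundary of a polygon.\<close>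

type_synonym pattern = "point set set"

definition unit_pattern :: "plane_graph \<Rightarrow> pattern \<Rightarrow> bool" where
  "unit_pattern G c \<longleftrightarrow>
     (\<exists>e \<in> edges G. c = {e} \<and> \<not> (\<exists>d. simple_cycle G d \<and> e \<in> d)) \<or> simple_cycle G c"

text \<open>The point set occupied by a pattern: the closed polygon bounded by a cycle, or, since
  a segment does not enclose any point, just the segment for a single edge.\<close>

definition region :: "pattern \<Rightarrow> point set" where
  "region c = (\<Union>e \<in> c. segment_of e) \<union> inside (\<Union>e \<in> c. segment_of e)"

text \<open>Polygons of a division may share boundary edges but not interior points.\<close>

definition division_into_patterns :: "plane_graph \<Rightarrow> pattern set \<Rightarrow> bool" where
  "division_into_patterns G P \<longleftrightarrow>
     (\<forall>c \<in> P. unit_pattern G c) \<and> \<Union>P = edges G \<and>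
     (\<forall>c \<in> P. \<forall>d \<in> P. c \<noteq> d \<longrightarrow> interior (region c) \<inter> interior (region d) = {})"

text \<open>The shape is the number of sides: 1 for an edge, 3 for a triangle, 4 for a rectangle, etc.\<close>

definition shape :: "pattern \<Rightarrow> nat" where
  "shape c = card c"

locale road_network =
  fixes G :: plane_graph
    and P :: "pattern set"
    and n :: nat
    and ptype :: "pattern \<Rightarrow> nat"
    and poi :: "pattern \<Rightarrow> real^'d"
  assumes simple: "simple_graph G"
    and connected: "connected_graph G"
    and embedded: "plane_embedded G"
    and division: "division_into_patterns G P"
    and types: "ptype ` P = {1..n}"
    and type_is_shape: "\<And>c d. c \<in> P \<Longrightarrow> d \<in> P \<Longrightarrow> ptype c = ptype d \<longleftrightarrow> shape c = shape d"
    and poi_nonneg: "\<And>c i. c \<in> P \<Longrightarrow> 0 \<le> poi c $ i"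
    and poi_normalized: "\<And>c. c \<in> P \<Longrightarrow> norm (poi c) = 1"

text \<open>The center is part of a community, as the distance to a query location refers to it.
  It is a vertex of the road network, not necessarily of the subgraph.\<close>

record community =
  center :: point
  subgraph :: plane_graph

text \<open>The unit patterns of a community are those of the division that it contains entirely.\<close>

definition patterns_of :: "pattern set \<Rightarrow> community \<Rightarrow> pattern set" where
  "patterns_of P C = {c \<in> P. c \<subseteq> edges (subgraph C)}"

definition mindist :: "pattern \<Rightarrow> point \<Rightarrow> real" where
  "mindist c v = infdist v (region c)"

definition spatial_community :: "plane_graph \<Rightarrow> pattern set \<Rightarrow> real \<Rightarrow> community \<Rightarrow> bool" where
  "spatial_community G P r C \<longleftrightarrow>
     center C \<in> verts G \<and> subgraph_of (subgraph C) G \<and> connected_graph (subgraph C) \<and>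
     (\<forall>c \<in> patterns_of P C. mindist c (center C) \<le> r)"

definition typed_patterns ::
    "pattern set \<Rightarrow> (pattern \<Rightarrow> nat) \<Rightarrow> community \<Rightarrow> nat \<Rightarrow> pattern set" where
  "typed_patterns P ptype C h = {c \<in> patterns_of P C. ptype c = h}"

definition query_community ::
    "plane_graph \<Rightarrow> pattern set \<Rightarrow> nat \<Rightarrow> (pattern \<Rightarrow> nat) \<Rightarrow> real \<Rightarrow> community \<Rightarrow> bool" where
  "query_community G P n ptype r Q \<longleftrightarrow>
     spatial_community G P r Q \<and> (\<forall>h \<in> {1..n}. 1 \<le> card (typed_patterns P ptype Q h))"

definition cos_sim :: "real^'d \<Rightarrow> real^'d \<Rightarrow> real" where
  "cos_sim A B = (\<Sum>i\<in>UNIV. A $ i * B $ i)"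

definition sim ::
    "pattern set \<Rightarrow> nat \<Rightarrow> (pattern \<Rightarrow> nat) \<Rightarrow> (pattern \<Rightarrow> real^'d) \<Rightarrow>
     community \<Rightarrow> community \<Rightarrow> real" where
  "sim P n ptype poi C Q =
     (\<Sum>h = 1..n.
        (\<Sum>c \<in> typed_patterns P ptype C h. \<Sum>q \<in> typed_patterns P ptype Q h.
           cos_sim (poi c) (poi q)) /
        (real (card (typed_patterns P ptype Q h)) * real n))"

definition query_dist :: "point \<Rightarrow> community \<Rightarrow> real" where
  "query_dist vq C = dist vq (center C)"

text \<open>A set of communities answering the query. There may be none (ties, or fewer than
  \<open>k\<close> communities reaching the threshold).\<close>

definition topk_answer ::
    "plane_graph \<Rightarrow> pattern set \<Rightarrow> nat \<Rightarrow> (pattern \<Rightarrow> nat) \<Rightarrow> (pattern \<Rightarrow> real^'d) \<Rightarrow> real \<Rightarrow>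
     community \<Rightarrow> point \<Rightarrow> real \<Rightarrow> nat \<Rightarrow> community set \<Rightarrow> bool" where
  "topk_answer G P n ptype poi r Q vq \<theta> k R \<longleftrightarrow>
     finite R \<and> card R = k \<and>
     (\<forall>C \<in> R. spatial_community G P r C \<and> sim P n ptype poi C Q \<ge> \<theta>) \<and>
     (\<forall>C \<in> R. \<forall>C'. spatial_community G P r C' \<and> C' \<notin> R \<and> sim P n ptype poi C' Q \<ge> \<theta> \<longrightarrow>
        query_dist vq C < query_dist vq C')"

end

theory Submission
  imports Defs
begin

text \<open>A pigeonhole argument: \<open>R\<close> has exactly \<open>k\<close> elements, so if it
  contains \<open>Cl\<close>, it has no room for all \<open>k\<close> distinct candidates and omits
  some \<open>C i\<close>. That candidate reaches the threshold, so the query ranks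
  \<open>Cl\<close> strictly nearer than \<open>C i\<close>, hence strictly nearer than
  \<open>C k\<close>, a contradiction. Ties in distance do no harm because this ranking is
  strict.\<close>

theorem theorem2:
  fixes G :: plane_graph and P :: "pattern set" and n :: nat
    and ptype :: "pattern \<Rightarrow> nat" and poi :: "pattern \<Rightarrow> real^'d"
    and r \<theta> :: real and Q Cl :: community and vq :: point and k :: nat
    and C :: "nat \<Rightarrow> community" and R :: "community set"
  assumes "road_network G P n ptype poi"
    and "query_community G P n ptype r Q"
    and "k \<ge> 1"
    and "\<And>i. i \<in> {1..k} \<Longrightarrow> spatial_community G P r (C i)"
    and "inj_on C {1..k}"
    and "\<And>i. i \<in> {1..k} \<Longrightarrow> sim P n ptype poi (C i) Q > \<theta>"
    and "\<And>i. i \<in> {1..k} \<Longrightarrow> query_dist vq (C i) \<le> query_dist vq (C k)"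
    and "spatial_community G P r Cl"
    and "Cl \<notin> C ` {1..k}"
    and "query_dist vq Cl \<ge> query_dist vq (C k)"
    and "topk_answer G P n ptype poi r Q vq \<theta> k R"
  shows "Cl \<notin> R"
proof
  assume "Cl \<in> R"
  have R: "finite R" "card R = k"
    and nearer: "\<And>D. \<lbrakk>spatial_community G P r D; D \<notin> R; \<theta> \<le> sim P n ptype poi D Q\<rbrakk>
      \<Longrightarrow> query_dist vq Cl < query_dist vq D"
    using assms(11) \<open>Cl \<in> R\<close> unfolding topk_answer_def by blast+
  have "C ` {1..k} \<noteq> R"
    using \<open>Cl \<in> R\<close> assms(9) by blast
  moreover have "card (C ` {1..k}) = card R"
    using assms(5) R by (simp add: card_image)
  \<comment> \<open>Between finite sets of equal size, inclusion would force equality, which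
    \<open>Cl\<close> rules out.\<close>
  ultimately have "\<not> C ` {1..k} \<subseteq> R"
    using R card_subset_eq by blast
  then obtain i where i: "i \<in> {1..k}" "C i \<notin> R"
    by blast
  \<comment> \<open>The omitted \<open>C i\<close> serves as the non-retrieved community against
    which the retrieved \<open>Cl\<close> is compared.\<close>
  have "query_dist vq Cl < query_dist vq (C i)"
    using nearer assms(4,6) i by (simp add: less_imp_le)
  also have "\<dots> \<le> query_dist vq (C k)"
    using assms(7) i by blast
  also have "\<dots> \<le> query_dist vq Cl"
    using assms(10) .
  finally show False
    by simp
qed

end
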